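(* For every integer $n \geq 1$, $$\int_0^1 \frac{\mathrm{Li}_{-2n-1}(-x^2)\, \ln\ln \frac{1}{x}}{x} \, dx = (-1)^n \left(1 - \frac{1}{2^{2n+1}}\right) \frac{(2n)!}{2}\,\frac{\zeta(2n+1)}{\pi^{2n}}.$$
   Context: For an integer $s$ and complex $z$ with $|z|<1$, the polylogarithm is $\mathrm{Li}_s(z) := \sum_{k=1}^{\infty} \frac{z^k}{k^s}$; in particular $\mathrm{Li}_{-2n-1}(-x^2) = \sum_{k=1}^\infty (-1)^k k^{2n+1} x^{2k}$ for $0<x<1$. $\zeta$ is the Riemann zeta function, and $\ln\ln\frac1x = \ln(\ln(1/x))$ for $0<x<1$. *)

theory Defs
  imports "HOL-Analysis.Analysis"
begin

text \<open>Only meaningful for \<open>norm z < 1\<close>, where the defining series converges for every integer \<open>s\<close>.\<close>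

definition polylog :: "int \<Rightarrow> complex \<Rightarrow> complex" where
  "polylog s z = (\<Sum>k. z ^ Suc k / of_nat (Suc k) powi s)"

text \<open>The Dirichlet series, which is the Riemann zeta function on the half-plane \<open>Re s > 1\<close>;
  it is not continued analytically, so values elsewhere are meaningless.\<close>

definition zeta :: "complex \<Rightarrow> complex" where
  "zeta s = (\<Sum>k. 1 / of_nat (Suc k) powr s)"

end

(* With t = -ln x and z = 1/2 + i t/pi one has exp(2 pi i z) = -x^2. Differentiating the reflection
   formula of the digamma function 2n+1 times at z (Lipschitz summation) turns the polylogarithm
   into a multiple of the sum of Re (a_k + i t)^(-2n-2) over a_k = pi (k + 1/2). Each term,
   multiplied by ln t, has an elementary antiderivative and integrates to
   -(pi/2) a_k^(-2n-1) / (2n+1); only the argument pi/2 of a_k + i t at infinity survives in the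
   real part. Summing over k gives the odd part of zeta(2n+1). Sum and integral may be exchanged
   because |ln t| / (a^2 + t^2)^(n+1) <= a^(-2) |ln t| / (1 + t^2). *)

theory Submission
  imports Defs "HOL-Real_Asymp.Real_Asymp"
begin

section \<open>The polylogarithm as a sum over shifted odd integers\<close>

text \<open>Induction on \<open>m\<close>: formal differentiation turns the coefficients n^m into
  (n+1)^(m+1) and keeps convergence in the unit disc. It needs convergence at every point of the
  disc, hence the arbitrary \<open>q\<close>.\<close>

lemma summable_nat_power_mult_power:
  fixes q :: complex
  assumes "norm q < 1"
  shows "summable (\<lambda>n. of_nat n ^ m * q ^ n)"
  using assms
proof (induction m arbitrary: q)
  case 0
  thus ?case by (simp add: summable_geometric)
next
  case (Suc m)
  have "summable (\<lambda>n. diffs (\<lambda>n. of_nat n ^ m) n * q ^ n)"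
    by (rule termdiff_converges[of _ 1]) (use Suc in auto)
  from summable_mult[OF this, of q] have "summable (\<lambda>n. of_nat (Suc n) ^ Suc m * q ^ Suc n)"
    by (simp add: diffs_def mult_ac)
  thus ?case by (subst (asm) summable_Suc_iff)
qed

text \<open>For \<open>m > 0\<close> this is the polylogarithm of order -m. Starting at n = 0 makes
  \<open>m = 0\<close> the full geometric series, since 0^0 = 1.\<close>

definition nat_power_series :: "nat \<Rightarrow> complex \<Rightarrow> complex" where
  "nat_power_series m q = (\<Sum>n. of_nat n ^ m * q ^ n)"

text \<open>The Euler operator q d/dq multiplies the n-th coefficient by n.\<close>

lemma has_field_derivative_nat_power_series:
  assumes "norm q < 1" "q \<noteq> 0"
  shows "(nat_power_series m has_field_derivative nat_power_series (Suc m) q / q) (at q)"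
proof -
  have "(nat_power_series m has_field_derivative (\<Sum>n. diffs (\<lambda>n. of_nat n ^ m) n * q ^ n)) (at q)"
    unfolding nat_power_series_def
    by (rule termdiffs_strong'[of 1]) (use assms summable_nat_power_mult_power in auto)
  also have "(\<Sum>n. diffs (\<lambda>n. of_nat n ^ m) n * q ^ n) = nat_power_series (Suc m) q / q"
  proof -
    have "summable (\<lambda>n. diffs (\<lambda>n. of_nat n ^ m) n * q ^ n)"
      by (rule termdiff_converges[of _ 1]) (use assms summable_nat_power_mult_power in auto)
    from suminf_mult[OF this, of q]
    have "q * (\<Sum>n. diffs (\<lambda>n. of_nat n ^ m) n * q ^ n) = (\<Sum>n. of_nat (Suc n) ^ Suc m * q ^ Suc n)"
      by (simp add: diffs_def mult_ac)
    also have "\<dots> = nat_power_series (Suc m) q"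
      unfolding nat_power_series_def
      by (subst suminf_split_head[OF summable_nat_power_mult_power[OF assms(1)]]) auto
    finally show ?thesis using assms by (simp add: field_simps)
  qed
  finally show ?thesis .
qed

section \<open>Reflection formulas for the digamma and polygamma functions\<close>

text \<open>Both sides of Gamma z * Gamma (1 - z) = pi / sin (pi z) are differentiated; dividing by
  this product leaves the logarithmic derivative.\<close>

lemma Digamma_reflection:
  fixes z :: complex
  assumes "z \<notin> \<int>"
  shows "Digamma (1 - z) - Digamma z = of_real pi * cos (of_real pi * z) / sin (of_real pi * z)"
proof -
  have z: "z \<notin> \<int>\<^sub>\<le>\<^sub>0" "1 - z \<notin> \<int>\<^sub>\<le>\<^sub>0"
    using assms by (auto dest: nonpos_Ints_Int Ints_diff[OF Ints_1])
  have s: "sin (of_real pi * z) \<noteq> 0"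
    using assms by (auto simp: sin_eq_0 mult.commute)
  let ?s = "sin (complex_of_real pi * z)" and ?c = "cos (complex_of_real pi * z)"
  have "((\<lambda>z. Gamma z * Gamma (1 - z)) has_field_derivative
          Gamma z * Gamma (1 - z) * (Digamma z - Digamma (1 - z))) (at z)"
    using z by (auto intro!: derivative_eq_intros simp: algebra_simps)
  moreover have "((\<lambda>z. Gamma z * Gamma (1 - z)) has_field_derivative
          - (of_real pi * (of_real pi * ?c) / ?s\<^sup>2)) (at z)"
    unfolding Gamma_reflection_complex using s
    by (auto intro!: derivative_eq_intros simp: power2_eq_square)
  ultimately have "of_real pi / ?s * (Digamma z - Digamma (1 - z)) =
      - (of_real pi * (of_real pi * ?c) / ?s\<^sup>2)"
    unfolding Gamma_reflection_complex by (rule DERIV_unique)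
  also have "\<dots> = of_real pi / ?s * (- (of_real pi * ?c / ?s))"
    by (simp add: power2_eq_square)
  finally have "Digamma z - Digamma (1 - z) = - (of_real pi * ?c / ?s)"
    using s by (subst (asm) mult_left_cancel) auto
  thus ?thesis by (simp add: algebra_simps)
qed

text \<open>With q = exp (2 pi i z), pi cot (pi z) equals i pi - 2 pi i / (1 - q). In the upper
  half-plane norm q < 1, so the fraction is a geometric series.\<close>

lemma Digamma_reflection_geometric:
  fixes z :: complex
  assumes "Im z > 0"
  shows "Digamma (1 - z) - Digamma z =
           \<i> * of_real pi - 2 * of_real pi * \<i> * nat_power_series 0 (exp (2 * of_real pi * \<i> * z))"
proof -
  define q where "q = exp (2 * of_real pi * \<i> * z)"
  define e where "e = exp (of_real pi * \<i> * z)"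
  have q: "q = e\<^sup>2" by (simp add: q_def e_def mult_ac flip: exp_double)
  have nq: "norm q < 1" using assms by (simp add: q_def mult_pos_pos)
  have "e \<noteq> 0" "e\<^sup>2 \<noteq> 1" using nq q by (auto simp: e_def)
  have z: "z \<notin> \<int>" using assms by (auto elim!: Ints_cases)
  have trig: "cos (of_real pi * z) = (e + inverse e) / 2" "sin (of_real pi * z) = (e - inverse e) / (2 * \<i>)"
    by (simp_all add: cos_exp_eq sin_exp_eq e_def exp_minus mult_ac)
  have "of_real pi * cos (of_real pi * z) / sin (of_real pi * z) = of_real pi * \<i> * (e\<^sup>2 + 1) / (e\<^sup>2 - 1)"
    unfolding trig using \<open>e \<noteq> 0\<close> \<open>e\<^sup>2 \<noteq> 1\<close>
    by (simp add: divide_simps power2_eq_square)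
  also have "\<dots> = \<i> * of_real pi - 2 * of_real pi * \<i> * (1 / (1 - q))"
    using \<open>e\<^sup>2 \<noteq> 1\<close> unfolding q by (simp add: divide_simps) (simp add: algebra_simps)
  also have "1 / (1 - q) = nat_power_series 0 q"
    using nq by (simp add: nat_power_series_def suminf_geometric)
  finally show ?thesis using Digamma_reflection[OF z] by (simp add: q_def)
qed

text \<open>Each differentiation in \<open>z\<close> contributes -1 on the reflected term and a
  factor 2 pi i on the series, whose exponent it raises. The constant i pi survives only for
  \<open>m = 0\<close>.\<close>

lemma Polygamma_reflection_power_series:
  fixes z :: complex
  assumes "Im z > 0"
  shows "(-1) ^ m * Polygamma m (1 - z) - Polygamma m z =
           (if m = 0 then \<i> * of_real pi else 0)
           - (2 * of_real pi * \<i>) ^ Suc m * nat_power_series m (exp (2 * of_real pi * \<i> * z))"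
  using assms
proof (induction m arbitrary: z)
  case 0
  thus ?case using Digamma_reflection_geometric[of z] by simp
next
  case (Suc m)
  define c where "c = 2 * complex_of_real pi * \<i>"
  let ?f = "\<lambda>z. (-1) ^ m * Polygamma m (1 - z) - Polygamma m z"
  let ?g = "\<lambda>z. (if m = 0 then \<i> * of_real pi else 0) - c ^ Suc m * nat_power_series m (exp (c * z))"
  have z: "z \<notin> \<int>\<^sub>\<le>\<^sub>0" "1 - z \<notin> \<int>\<^sub>\<le>\<^sub>0"
    using Suc.prems by (auto elim!: nonpos_Ints_cases simp: complex_eq_iff)
  have nq: "norm (exp (c * z)) < 1" using Suc.prems by (simp add: c_def mult_pos_pos)
  have "(?f has_field_derivative (-1) ^ Suc m * Polygamma (Suc m) (1 - z) - Polygamma (Suc m) z) (at z)"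
    using z by (auto intro!: derivative_eq_intros)
  moreover have "((\<lambda>z. nat_power_series m (exp (c * z))) has_field_derivative
       nat_power_series (Suc m) (exp (c * z)) / exp (c * z) * (exp (c * z) * c)) (at z)"
    by (rule DERIV_chain2[OF has_field_derivative_nat_power_series])
       (use nq in \<open>auto intro!: derivative_eq_intros\<close>)
  hence "(?g has_field_derivative 0 - c ^ Suc (Suc m) * nat_power_series (Suc m) (exp (c * z))) (at z)"
    by (auto intro!: derivative_eq_intros simp: mult_ac)
  \<comment> \<open>The induction hypothesis identifies the two functions only on the upper
    half-plane; as that set is open, the derivative transfers.\<close>
  hence "(?f has_field_derivative 0 - c ^ Suc (Suc m) * nat_power_series (Suc m) (exp (c * z))) (at z)"
  proof (rule has_field_derivative_transform_within_open)
    show "open {z. Im z > 0}" by (rule open_halfspace_Im_gt)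
    show "?g w = ?f w" if "w \<in> {z. Im z > 0}" for w
      using Suc.IH[of w] that by (simp add: c_def)
  qed (use Suc.prems in auto)
  ultimately have "(-1) ^ Suc m * Polygamma (Suc m) (1 - z) - Polygamma (Suc m) z =
     0 - c ^ Suc (Suc m) * nat_power_series (Suc m) (exp (c * z))"
    by (rule DERIV_unique)
  thus ?case by (simp add: c_def)
qed

section \<open>Polylogarithms of negative odd order as real parts of a shifted series\<close>

text \<open>The term at n = 0 vanishes because \<open>m > 0\<close>; for \<open>m = 0\<close> the
  two sides would differ by 1.\<close>

lemma polylog_neg_eq_nat_power_series:
  assumes "norm z < 1" "m > 0"
  shows "polylog (- int m) z = nat_power_series m z"
proof -
  have "polylog (- int m) z = (\<Sum>k. of_nat (Suc k) ^ m * z ^ Suc k)"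
    unfolding polylog_def by (simp add: power_int_minus divide_inverse mult.commute del: of_nat_Suc)
  also have "\<dots> = nat_power_series m z"
    unfolding nat_power_series_def
    by (subst suminf_split_head[OF summable_nat_power_mult_power[OF assms(1)]]) (use assms in auto)
  finally show ?thesis .
qed

text \<open>On the line Re z = 1/2 the reflection 1 - z is complex conjugation. Since m = 2n+1 is
  odd, the reflection formula concerns the sum of two conjugate polygamma values, that is, a series
  of doubled real parts. All its terms being real, the polylogarithm is real too.\<close>

lemma polylog_neg_odd_sums:
  assumes "0 < x" "x < 1"
  shows "(\<lambda>k. Re (inverse (Complex (pi * (real k + 1 / 2)) (- ln x)) ^ (2 * n + 2)))
           sums ((-1) ^ Suc n * 2 ^ (2 * n + 1) / fact (2 * n + 1)
             * Re (polylog (- 2 * int n - 1) (- (complex_of_real x)\<^sup>2)))"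
    and "Im (polylog (- 2 * int n - 1) (- (complex_of_real x)\<^sup>2)) = 0"
proof -
  define m where "m = 2 * n + 1"
  define z where "z = Complex (1 / 2) (- ln x / pi)"
  have z: "Im z > 0" "z \<noteq> 0" using assms by (auto simp: z_def complex_eq_iff divide_neg_pos)
  have cz: "1 - z = cnj z" by (simp add: z_def complex_eq_iff)
  have q: "exp (2 * of_real pi * \<i> * z) = - (complex_of_real x)\<^sup>2"
  proof -
    have "2 * of_real pi * \<i> * z = \<i> * of_real pi + of_real (2 * ln x)"
      by (simp add: z_def complex_eq_iff)
    also have "exp \<dots> = - of_real (exp (2 * ln x))" by (simp add: exp_add exp_of_real del: of_real_mult)
    also have "exp (2 * ln x) = x\<^sup>2" using assms by (simp add: exp_double)
    finally show ?thesis by simp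
  qed
  have "norm (- (complex_of_real x)\<^sup>2) < 1"
    using assms by (simp add: norm_power power_less_one_iff)
  hence poly: "polylog (- int m) (- (complex_of_real x)\<^sup>2) = nat_power_series m (- (complex_of_real x)\<^sup>2)"
    by (intro polylog_neg_eq_nat_power_series) (auto simp: m_def)
  define P where "P = polylog (- int m) (- (complex_of_real x)\<^sup>2)"
  define T where "T = (\<lambda>k. inverse ((z + of_nat k) ^ Suc m))"
  \<comment> \<open>The sign (-1)^(m+1) in the series of the polygamma function is 1 because
    \<open>m\<close> is odd.\<close>
  have T: "T sums (Polygamma m z / fact m)"
    using Polygamma_LIMSEQ[OF z(2), of m] by (simp add: T_def m_def)
  have T': "(\<lambda>k. cnj (T k)) sums (Polygamma m (1 - z) / fact m)"
    using Polygamma_LIMSEQ[of "1 - z" m] z(2) cz by (simp add: T_def m_def)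
  from sums_add[OF T T'] have "(\<lambda>k. complex_of_real (2 * Re (T k))) sums
      ((Polygamma m z + Polygamma m (1 - z)) / fact m)"
    by (simp add: complex_add_cnj add_divide_distrib)
  also have "Polygamma m z + Polygamma m (1 - z) = (2 * of_real pi * \<i>) ^ Suc m * P"
  proof -
    have m: "(-1) ^ m = (-1 :: complex)" "m \<noteq> 0" by (simp_all add: m_def)
    have "- u - v = - w \<Longrightarrow> v + u = w" for u v w :: complex by algebra
    thus ?thesis using Polygamma_reflection_power_series[OF z(1), of m] poly m
      by (simp add: P_def q del: power_Suc)
  qed
  also have "(2 * complex_of_real pi * \<i>) ^ Suc m = of_real ((-1) ^ Suc n * (2 * pi) ^ (2 * n + 2))"
  proof -
    have "(2 * complex_of_real pi * \<i>) ^ Suc m = ((2 * complex_of_real pi * \<i>)\<^sup>2) ^ Suc n"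
      unfolding power_mult[symmetric] by (simp add: m_def)
    also have "(2 * complex_of_real pi * \<i>)\<^sup>2 = of_real (- ((2 * pi)\<^sup>2))"
      by (simp add: power_mult_distrib)
    also have "of_real (- ((2 * pi)\<^sup>2)) ^ Suc n =
        complex_of_real ((-1) ^ Suc n * ((2 * pi)\<^sup>2) ^ Suc n)"
      unfolding of_real_power[symmetric] by (subst power_minus) simp
    also have "((2 * pi)\<^sup>2) ^ Suc n = (2 * pi) ^ (2 * n + 2)"
      unfolding power_mult[symmetric] by simp
    finally show ?thesis .
  qed
  finally have S: "(\<lambda>k. complex_of_real (2 * Re (T k))) sums
      (of_real ((-1) ^ Suc n * (2 * pi) ^ (2 * n + 2)) * P / fact m)" .
  define R where "R = (\<lambda>k. Re (inverse (Complex (pi * (real k + 1 / 2)) (- ln x)) ^ (2 * n + 2)))"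
  have ReT: "Re (T k) = pi ^ (2 * n + 2) * R k" for k
  proof -
    have C: "Complex (pi * (real k + 1 / 2)) (- ln x) = of_real pi * (z + of_nat k)"
      by (simp add: z_def complex_eq_iff algebra_simps)
    have "inverse (w ^ p) = of_real (pi ^ p) * inverse (of_real pi * w) ^ p" for w :: complex and p
      by (simp add: power_inverse power_mult_distrib)
    from this[of "z + of_nat k" "2 * n + 2"]
    have "T k = of_real (pi ^ (2 * n + 2)) *
        inverse (Complex (pi * (real k + 1 / 2)) (- ln x)) ^ (2 * n + 2)"
      unfolding C by (simp add: T_def m_def)
    thus ?thesis unfolding R_def by (simp only: Re_complex_of_real times_complex.simps Im_complex_of_real)
  qed
  define K where "K = (-1) ^ Suc n * (2 * pi) ^ (2 * n + 2) / fact m"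
  have "of_real ((-1) ^ Suc n * (2 * pi) ^ (2 * n + 2)) * P / fact m = of_real K * P"
    unfolding K_def by (simp only: of_real_divide of_real_fact times_divide_eq_left)
  note S = S[unfolded this]
  have int: "- 2 * int n - 1 = - int m" by (simp add: m_def)
  have "K \<noteq> 0" by (simp add: K_def)
  \<comment> \<open>The series has real terms, so its limit \<open>K * P\<close> with real nonzero
    \<open>K\<close> has imaginary part 0.\<close>
  from sums_Im[OF S] have "K * Im P = 0" by (simp add: sums_iff)
  with \<open>K \<noteq> 0\<close> show "Im (polylog (- 2 * int n - 1) (- (complex_of_real x)\<^sup>2)) = 0"
    unfolding int P_def[symmetric] by simp
  \<comment> \<open>The factor 2 comes from adding conjugates, the power of pi from rescaling z + k
    to pi (z + k).\<close>
  from sums_mult[OF sums_Re[OF S], of "inverse (2 * pi ^ (2 * n + 2))"]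
  moreover have "inverse (2 * pi ^ (2 * n + 2)) * Re (complex_of_real (2 * Re (T k))) = R k" for k
    unfolding ReT Re_complex_of_real by (simp del: power_add add_2_eq_Suc')
  moreover have "Re (of_real K * P) = K * Re P" by simp
  ultimately have "R sums (inverse (2 * pi ^ (2 * n + 2)) * (K * Re P))"
    by (simp only:)
  also have "inverse (2 * pi ^ (2 * n + 2)) * (K * Re P) =
      (-1) ^ Suc n * 2 ^ (2 * n + 1) / fact (2 * n + 1) * Re P"
    by (simp add: K_def m_def power_mult_distrib field_simps)
  finally show "(\<lambda>k. Re (inverse (Complex (pi * (real k + 1 / 2)) (- ln x)) ^ (2 * n + 2)))
           sums ((-1) ^ Suc n * 2 ^ (2 * n + 1) / fact (2 * n + 1)
             * Re (polylog (- 2 * int n - 1) (- (complex_of_real x)\<^sup>2)))"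
    unfolding int P_def[symmetric] R_def .
qed

section \<open>Zeta values at integers\<close>

text \<open>At a natural exponent \<open>powr\<close> is an ordinary power, so the complex series is
  the embedding of a convergent real one.\<close>

lemma zeta_nat_sums:
  assumes "s \<ge> 2"
  shows "(\<lambda>k. 1 / real (Suc k) ^ s) sums Re (zeta (of_nat s))" "Im (zeta (of_nat s)) = 0"
proof -
  have "summable (\<lambda>k. 1 / real (Suc k) ^ s)"
    using inverse_power_summable[of s, where 'a = real] assms
    by (subst summable_Suc_iff) (simp add: divide_inverse)
  hence "(\<lambda>k. complex_of_real (1 / real (Suc k) ^ s)) sums of_real (\<Sum>k. 1 / real (Suc k) ^ s)"
    by (intro sums_of_real summable_sums)
  moreover have "complex_of_real (1 / real (Suc k) ^ s) = 1 / of_nat (Suc k) powr of_nat s" for k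
    by (simp add: powr_nat' del: of_nat_Suc)
  ultimately have "zeta (of_nat s) = of_real (\<Sum>k. 1 / real (Suc k) ^ s)"
    unfolding zeta_def by (simp add: sums_iff)
  thus "(\<lambda>k. 1 / real (Suc k) ^ s) sums Re (zeta (of_nat s))" "Im (zeta (of_nat s)) = 0"
    using \<open>summable _\<close> by (simp_all add: summable_sums)
qed

text \<open>The terms of the zeta series are grouped in pairs; the even ones add up to zeta(s) / 2^s
  and are subtracted.\<close>

lemma odd_power_sums:
  assumes "s \<ge> 2"
  shows "(\<lambda>k. 1 / real (2 * k + 1) ^ s) sums ((1 - 1 / 2 ^ s) * Re (zeta (of_nat s)))"
proof -
  note Z = zeta_nat_sums(1)[OF assms]
  have "(\<lambda>k. 1 / real (2 * k + 1) ^ s + 1 / real (2 * k + 2) ^ s) sums Re (zeta (of_nat s))"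
    using sums_group[OF Z, of 2] by (simp add: mult.commute numeral_2_eq_2)
  from sums_diff[OF this sums_mult[OF Z, of "1 / 2 ^ s"]]
  have "(\<lambda>k. 1 / real (2 * k + 1) ^ s + 1 / real (2 * k + 2) ^ s - 1 / 2 ^ s * (1 / real (Suc k) ^ s))
      sums (Re (zeta (of_nat s)) - 1 / 2 ^ s * Re (zeta (of_nat s)))" .
  moreover have "1 / real (2 * k + 2) ^ s = 1 / 2 ^ s * (1 / real (Suc k) ^ s)" for k
    by (simp add: flip: power_mult_distrib)
  ultimately show ?thesis by (simp add: algebra_simps)
qed

section \<open>The logarithmic integral of an inverse power\<close>

text \<open>The right-hand side has the antiderivative \<open>8 * arctan (sqrt t)\<close>.\<close>

lemma abs_ln_div_le:
  fixes t :: real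
  assumes "t > 0"
  shows "\<bar>ln t\<bar> / (1 + t\<^sup>2) \<le> 4 / (sqrt t * (1 + t))"
proof -
  \<comment> \<open>Since ln t = 2 ln s, applying ln u \<le> u - 1 at u = s and at u = 1 / s bounds
    the logarithm by s + 1 / s, which controls it both near infinity and near 0.\<close>
  define s where "s = sqrt t"
  have s: "s > 0" "t = s\<^sup>2" using assms by (auto simp: s_def)
  have "ln s \<le> s" "- ln s \<le> 1 / s"
    using ln_le_minus_one[of s] ln_le_minus_one[of "1 / s"] s by (auto simp: ln_div)
  hence "\<bar>ln s\<bar> \<le> s + 1 / s" using s by (auto simp: abs_if intro: order_trans add_increasing add_increasing2)
  hence "\<bar>ln t\<bar> \<le> 2 * (s + 1 / s)" using s by (simp add: ln_realpow abs_mult)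
  also have "\<dots> = 2 * (1 + t) / s" using s by (simp add: field_simps power2_eq_square)
  finally have 1: "\<bar>ln t\<bar> \<le> 2 * (1 + t) / s" .
  \<comment> \<open>This trades 1 + t^2 for (1 + t)^2, one factor of which cancels against the bound
    on the logarithm.\<close>
  have "0 \<le> (1 - t)\<^sup>2" by simp
  hence "(1 + t)\<^sup>2 \<le> 2 * (1 + t\<^sup>2)" by (simp add: power2_eq_square algebra_simps)
  have "(1 + t) / (1 + t\<^sup>2) \<le> 2 / (1 + t)"
    using assms \<open>(1 + t)\<^sup>2 \<le> _\<close> by (simp add: divide_simps power2_eq_square add_pos_pos split: if_splits)
  hence "2 / s * ((1 + t) / (1 + t\<^sup>2)) \<le> 2 / s * (2 / (1 + t))"
    using s by (intro mult_left_mono) auto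
  moreover have "\<bar>ln t\<bar> / (1 + t\<^sup>2) \<le> (2 * (1 + t) / s) / (1 + t\<^sup>2)"
    using 1 by (intro divide_right_mono) auto
  ultimately show ?thesis by (simp add: s_def)
qed

text \<open>The bound of \<open>abs_ln_div_le\<close> pulled back along t = - ln x. For a
  nonnegative integrand, finite limits of an antiderivative at both ends already give
  integrability.\<close>

lemma set_integrable_dominator:
  "set_integrable lborel {0<..<1::real} (\<lambda>x. 4 / (sqrt (- ln x) * (1 - ln x)) / x)"
proof -
  have "set_integrable lborel (einterval (ereal 0) (ereal 1)) (\<lambda>x. 4 / (sqrt (- ln x) * (1 - ln x)) / x)"
  proof (rule interval_integral_FTC_nonneg)
    fix x :: real assume x: "ereal 0 < ereal x" "ereal x < ereal 1"
    hence l: "ln x < 0" by simp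
    show "((\<lambda>x. - 8 * arctan (sqrt (- ln x))) has_real_derivative
            4 / (sqrt (- ln x) * (1 - ln x)) / x) (at x)"
      using x l by (auto intro!: derivative_eq_intros simp: divide_simps)
    have "sqrt (- ln x) * (1 - ln x) \<noteq> 0" using l by simp
    thus "isCont (\<lambda>x. 4 / (sqrt (- ln x) * (1 - ln x)) / x) x"
      using x by (intro continuous_intros) auto
  next
    have top: "filterlim (\<lambda>x::real. sqrt (- ln x)) at_top (at_right 0)" by real_asymp
    show "(((\<lambda>x. - 8 * arctan (sqrt (- ln x))) \<circ> real_of_ereal) \<longlongrightarrow> - 4 * pi) (at_right (ereal 0))"
      unfolding ereal_tendsto_simps using tendsto_mult_left[OF filterlim_compose[OF tendsto_arctan_at_top top], of "- 8"] by simp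
    show "(((\<lambda>x. - 8 * arctan (sqrt (- ln x))) \<circ> real_of_ereal) \<longlongrightarrow> 0) (at_left (ereal 1))"
      unfolding ereal_tendsto_simps by real_asymp
    show "AE x in lborel. ereal 0 < ereal x \<longrightarrow> ereal x < ereal 1 \<longrightarrow>
            0 \<le> 4 / (sqrt (- ln x) * (1 - ln x)) / x"
    proof (intro AE_I2 impI)
      fix x :: real assume x: "ereal 0 < ereal x" "ereal x < ereal 1"
      hence "ln x \<le> 0" by simp
      hence "0 \<le> 1 - ln x" by linarith
      thus "0 \<le> 4 / (sqrt (- ln x) * (1 - ln x)) / x" using x by simp
    qed
  qed simp
  thus ?thesis by simp
qed

text \<open>The substitution t = - ln x, done through the antiderivative - G (- ln x). The integrand
  will change sign with ln t, so integrability is supplied as a hypothesis. The substitution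
  reverses orientation: x near 0 corresponds to t near infinity.\<close>

lemma set_integral_ln_pullback:
  fixes g G :: "real \<Rightarrow> real"
  assumes "\<And>t. t > 0 \<Longrightarrow> (G has_real_derivative g t) (at t)"
    and "\<And>t. t > 0 \<Longrightarrow> isCont g t"
    and int: "set_integrable lborel {0<..<1} (\<lambda>x. g (- ln x) / x)"
    and lim: "(G \<longlongrightarrow> A) (at_right 0)" "(G \<longlongrightarrow> B) at_top"
  shows "(LBINT x:{0<..<1}. g (- ln x) / x) = B - A"
proof -
  have "(LBINT x=ereal 0..ereal 1. g (- ln x) / x) = (- A) - (- B)"
  proof (rule interval_integral_FTC_integrable)
    fix x :: real assume x: "ereal 0 < ereal x" "ereal x < ereal 1"
    hence l: "- ln x > 0" by simp
    have "((\<lambda>x. G (- ln x)) has_real_derivative g (- ln x) * (- (1 / x))) (at x)"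
      by (rule DERIV_chain2[where f = G and g = "\<lambda>x. - ln x", OF assms(1)[OF l]]) (use x in \<open>auto intro!: derivative_eq_intros\<close>)
    from DERIV_minus[OF this]
    show "((\<lambda>x. - G (- ln x)) has_vector_derivative g (- ln x) / x) (at x)"
      by (simp add: has_real_derivative_iff_has_vector_derivative)
    show "isCont (\<lambda>x. g (- ln x) / x) x"
      using x by (intro continuous_intros isCont_o2[where f = "\<lambda>x. - ln x" and g = g, OF _ assms(2)[OF l]]) auto
  next
    have "filterlim (\<lambda>x::real. - ln x) at_top (at_right 0)" by real_asymp
    from filterlim_compose[OF lim(2) this]
    show "(((\<lambda>x. - G (- ln x)) \<circ> real_of_ereal) \<longlongrightarrow> - B) (at_right (ereal 0))"
      unfolding ereal_tendsto_simps by (rule tendsto_minus)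
    have "filterlim (\<lambda>x::real. - ln x) (at_right 0) (at_left 1)" by real_asymp
    from filterlim_compose[OF lim(1) this]
    show "(((\<lambda>x. - G (- ln x)) \<circ> real_of_ereal) \<longlongrightarrow> - A) (at_left (ereal 1))"
      unfolding ereal_tendsto_simps by (rule tendsto_minus)
  qed (use int in auto)
  thus ?thesis by (simp add: interval_lebesgue_integral_def)
qed

section \<open>An explicit antiderivative of the kernel and its limits\<close>

text \<open>Obtained from \<open>ln t / (a + \<i> t) ^ Suc m\<close> by integration by parts and the partial fraction
  decomposition of \<open>1 / (t (a + \<i> t) ^ m)\<close>; the constant \<open>a ^ (- m)\<close> subtracted next to \<open>ln t\<close>
  keeps the function bounded at \<open>0\<close>.\<close>

definition ln_kernel_prim :: "nat \<Rightarrow> real \<Rightarrow> real \<Rightarrow> complex" where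
  "ln_kernel_prim m a t = \<i> / of_nat m *
     ((inverse (Complex a t) ^ m - inverse (of_real a) ^ m) * of_real (ln t)
      + inverse (of_real a) ^ m * Ln (Complex a t)
      - (\<Sum>j\<in>{1..<m}. inverse (of_real a) ^ (m - j) * inverse (Complex a t) ^ j / of_nat j))"

text \<open>The difference of the bases is - i t times their product. The resulting factor t cancels
  the 1 / t coming from the derivative of ln t and tames ln t near 0.\<close>

lemma inverse_power_diff_Complex:
  assumes "a > 0"
  shows "inverse (Complex a t) ^ m - inverse (of_real a) ^ m =
           - \<i> * of_real t * (\<Sum>j<m. inverse (of_real a) ^ (m - j) * inverse (Complex a t) ^ Suc j)"
proof -
  define x y where "x = inverse (Complex a t)" and "y = inverse (complex_of_real a)"
  have nz: "Complex a t \<noteq> 0" using assms by (auto simp: complex_eq_iff)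
  have "y - x = (Complex a t - of_real a) * x * y"
    using nz assms by (simp add: x_def y_def field_simps)
  also have "Complex a t - of_real a = \<i> * of_real t" by (simp add: complex_eq_iff)
  finally have "y - x = \<i> * of_real t * x * y" .
  hence "x - y = - \<i> * of_real t * x * y" by (simp add: algebra_simps)
  hence "x ^ m - y ^ m = - \<i> * of_real t * x * y * (\<Sum>j<m. y ^ (m - Suc j) * x ^ j)"
    by (simp add: power_diff_sumr2)
  also have "\<dots> = - \<i> * of_real t * (\<Sum>j<m. (y * y ^ (m - Suc j)) * (x * x ^ j))"
    by (simp add: sum_distrib_left mult_ac)
  also have "(\<Sum>j<m. (y * y ^ (m - Suc j)) * (x * x ^ j)) = (\<Sum>j<m. y ^ (m - j) * x ^ Suc j)"
    by (intro sum.cong refl arg_cong2[where f = "(*)"])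
       (simp_all add: Suc_diff_Suc flip: power_Suc)
  finally show ?thesis by (simp add: x_def y_def)
qed

text \<open>Differentiation takes place for a complex argument, followed by restriction to the real
  line.\<close>

lemma has_vector_derivative_inverse_power_Complex:
  assumes "a > 0"
  shows "((\<lambda>t. inverse (Complex a t) ^ j) has_vector_derivative
            - (of_nat j * \<i> * inverse (Complex a t) ^ Suc j)) (at t)"
proof -
  have nz: "Complex a t \<noteq> 0" using assms by (auto simp: complex_eq_iff)
  have "((\<lambda>z. inverse (of_real a + \<i> * z)) has_field_derivative
          - (\<i> * inverse (Complex a t) ^ 2)) (at (complex_of_real t))"
    using nz by (auto intro!: derivative_eq_intros simp: Complex_eq field_simps power2_eq_square)
  from DERIV_power[OF this, of j]
  have "((\<lambda>z. inverse (of_real a + \<i> * z) ^ j) has_field_derivative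
          - (of_nat j * \<i> * inverse (Complex a t) ^ Suc j)) (at (complex_of_real t))"
    by (cases j) (simp_all add: Complex_eq power2_eq_square mult_ac)
  from has_vector_derivative_real_field[OF this] show ?thesis by (simp add: Complex_eq o_def)
qed

lemma has_vector_derivative_Ln_Complex:
  assumes "a > 0"
  shows "((\<lambda>t. Ln (Complex a t)) has_vector_derivative \<i> * inverse (Complex a t)) (at t)"
proof -
  have "Complex a t \<notin> \<real>\<^sub>\<le>\<^sub>0" using assms by (auto simp: complex_nonpos_Reals_iff)
  hence "((\<lambda>z. Ln (of_real a + \<i> * z)) has_field_derivative \<i> * inverse (Complex a t)) (at (complex_of_real t))"
    by (auto intro!: derivative_eq_intros simp: Complex_eq field_simps)
  from has_vector_derivative_real_field[OF this] show ?thesis by (simp add: Complex_eq o_def)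
qed

text \<open>Differentiating the power next to ln t gives the kernel. The quotient by t left over
  from differentiating ln t is cancelled by the derivatives of \<open>Ln\<close> and of the finite
  sum.\<close>

lemma has_vector_derivative_ln_kernel_prim:
  assumes "a > 0" "t > 0" "m > 0"
  shows "(ln_kernel_prim m a has_vector_derivative
           inverse (Complex a t) ^ Suc m * of_real (ln t)) (at t)"
proof -
  define x y where "x = inverse (Complex a t)" and "y = inverse (complex_of_real a)"
  have nz: "Complex a t \<noteq> 0" using assms by (auto simp: complex_eq_iff)
  have ln: "((\<lambda>t. complex_of_real (ln t)) has_vector_derivative of_real (1 / t)) (at t)"
    using assms by (intro has_vector_derivative_of_real)
      (auto intro!: derivative_eq_intros simp flip: has_real_derivative_iff_has_vector_derivative)
  have "(ln_kernel_prim m a has_vector_derivative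
      \<i> / of_nat m * (((x ^ m - y ^ m) * of_real (1 / t) + - (of_nat m * \<i> * x ^ Suc m) * of_real (ln t))
        + y ^ m * (\<i> * x)
        - (\<Sum>j\<in>{1..<m}. y ^ (m - j) * - (of_nat j * \<i> * x ^ Suc j) / of_nat j))) (at t)"
    (is "(_ has_vector_derivative ?D) _")
    unfolding ln_kernel_prim_def x_def y_def
    by (intro has_vector_derivative_mult_right has_vector_derivative_diff has_vector_derivative_add
          has_vector_derivative_sum has_vector_derivative_divide ln
          has_vector_derivative_Ln_Complex[OF assms(1)]
          has_vector_derivative_mult[OF has_vector_derivative_diff[OF
            has_vector_derivative_inverse_power_Complex[OF assms(1)] has_vector_derivative_const], simplified diff_0_right]
          has_vector_derivative_inverse_power_Complex[OF assms(1)])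
  also have "?D = \<i> / of_nat m * ((x ^ m - y ^ m) / of_real t
        + (y ^ m * (\<i> * x) + (\<Sum>j\<in>{1..<m}. \<i> * (y ^ (m - j) * x ^ Suc j))))
        + x ^ Suc m * of_real (ln t)"
  proof -
    have "(\<Sum>j\<in>{1..<m}. y ^ (m - j) * - (of_nat j * \<i> * x ^ Suc j) / of_nat j) =
          - (\<Sum>j\<in>{1..<m}. \<i> * (y ^ (m - j) * x ^ Suc j))"
      unfolding sum_negf[symmetric] by (intro sum.cong) auto
    thus ?thesis using assms(3) by (simp only:) (simp add: field_simps)
  qed
  \<comment> \<open>The derivative of \<open>Ln\<close> is the term j = 0, whose antiderivative is
    not a power and so is absent from the sum over \<open>{1..<m}\<close>.\<close>
  also have "y ^ m * (\<i> * x) + (\<Sum>j\<in>{1..<m}. \<i> * (y ^ (m - j) * x ^ Suc j)) =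
             (\<Sum>j<m. \<i> * (y ^ (m - j) * x ^ Suc j))"
    using sum.atLeast_Suc_lessThan[of 0 m "\<lambda>j. \<i> * (y ^ (m - j) * x ^ Suc j)"] assms(3)
    by (simp add: atLeast0LessThan mult_ac)
  also have "(x ^ m - y ^ m) / of_real t = - (\<Sum>j<m. \<i> * (y ^ (m - j) * x ^ Suc j))"
    using inverse_power_diff_Complex[OF assms(1), of t m] assms(2)
    unfolding x_def[symmetric] y_def[symmetric] sum_distrib_left[symmetric] by simp
  finally show ?thesis by (simp add: x_def)
qed

text \<open>The part with ln t is O(t ln t). Everything else tends to i times a real number, because
  Complex a 0 is the positive real \<open>a\<close>.\<close>

lemma ln_kernel_prim_tendsto_0:
  assumes "a > 0" "m > 0"
  shows "((\<lambda>t. Re (ln_kernel_prim m a t)) \<longlongrightarrow> 0) (at_right 0)"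
proof -
  have nz: "Complex a t \<noteq> 0" "Complex a t \<notin> \<real>\<^sub>\<le>\<^sub>0" for t
    using assms by (auto simp: complex_eq_iff complex_nonpos_Reals_iff)
  have C: "((\<lambda>t. Complex a t) \<longlongrightarrow> Complex a 0) (at_right 0)"
    by (intro tendsto_intros)
  have I: "((\<lambda>t. inverse (Complex a t) ^ j) \<longlongrightarrow> inverse (Complex a 0) ^ j) (at_right 0)" for j
    using nz[of 0] by (intro tendsto_intros C)
  define S where "S = (\<lambda>t. \<Sum>j<m. inverse (complex_of_real a) ^ (m - j) * inverse (Complex a t) ^ Suc j)"
  have "(S \<longlongrightarrow> (\<Sum>j<m. inverse (complex_of_real a) ^ (m - j) * inverse (Complex a 0) ^ Suc j)) (at_right 0)"
    unfolding S_def by (intro tendsto_sum tendsto_mult tendsto_const I)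
  moreover have "((\<lambda>t::real. t * ln t) \<longlongrightarrow> 0) (at_right 0)" by real_asymp
  ultimately have "((\<lambda>t. - \<i> * S t * complex_of_real (t * ln t)) \<longlongrightarrow>
      - \<i> * (\<Sum>j<m. inverse (complex_of_real a) ^ (m - j) * inverse (Complex a 0) ^ Suc j)
        * of_real 0) (at_right 0)"
    by (intro tendsto_mult tendsto_of_real tendsto_const)
  hence "((\<lambda>t. - \<i> * S t * complex_of_real (t * ln t)) \<longlongrightarrow> 0) (at_right 0)"
    by simp
  moreover have "- \<i> * S t * complex_of_real (t * ln t) =
     (inverse (Complex a t) ^ m - inverse (of_real a) ^ m) * of_real (ln t)" for t
    unfolding inverse_power_diff_Complex[OF assms(1)] S_def by (simp add: mult_ac)
  ultimately have 1: "((\<lambda>t. (inverse (Complex a t) ^ m - inverse (of_real a) ^ m) * of_real (ln t))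
     \<longlongrightarrow> 0) (at_right 0)" by simp
  have "((\<lambda>t. Re (ln_kernel_prim m a t)) \<longlongrightarrow> Re (\<i> / of_nat m *
     (0 + inverse (of_real a) ^ m * Ln (Complex a 0)
      - (\<Sum>j\<in>{1..<m}. inverse (of_real a) ^ (m - j) * inverse (Complex a 0) ^ j / of_nat j)))) (at_right 0)"
    unfolding ln_kernel_prim_def
    by (intro tendsto_Re tendsto_mult tendsto_add tendsto_diff tendsto_const 1 tendsto_sum
        tendsto_divide I tendsto_Ln nz C) auto
  also have "Complex a 0 = of_real a" by (simp add: complex_eq_iff)
  also have "\<i> / of_nat m * (0 + inverse (of_real a) ^ m * Ln (of_real a)
      - (\<Sum>j\<in>{1..<m}. inverse (of_real a) ^ (m - j) * inverse (of_real a) ^ j / of_nat j)) =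
     \<i> * complex_of_real (1 / of_nat m * (inverse a ^ m * ln a
       - (\<Sum>j\<in>{1..<m}. inverse a ^ (m - j) * inverse a ^ j / of_nat j)))"
    using assms by (simp add: Ln_of_real)
  also have "Re \<dots> = 0" by simp
  finally show ?thesis .
qed

lemma norm_inverse_Complex_le:
  assumes "t > 0"
  shows "norm (inverse (Complex a t)) \<le> 1 / t"
  using abs_Im_le_cmod[of "Complex a t"] assms le_imp_inverse_le[of t "norm (Complex a t)"]
  by (simp add: norm_inverse divide_inverse del: complex_norm)

lemma tendsto_inverse_Complex_at_top: "((\<lambda>t. inverse (Complex a t)) \<longlongrightarrow> 0) at_top"
proof (rule Lim_null_comparison)
  show "\<forall>\<^sub>F t in at_top. norm (inverse (Complex a t)) \<le> 1 / t"
    using eventually_gt_at_top[of 0] by eventually_elim (rule norm_inverse_Complex_le)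
  show "((\<lambda>t::real. 1 / t) \<longlongrightarrow> 0) at_top" by real_asymp
qed

text \<open>The two logarithms combine to Ln (a + i t) - ln t, which tends to Ln i = i pi / 2.
  Positive powers of 1 / (a + i t) vanish, even when multiplied by ln t.\<close>

lemma ln_kernel_prim_tendsto_top:
  assumes "a > 0" "m > 0"
  shows "((\<lambda>t. Re (ln_kernel_prim m a t)) \<longlongrightarrow> - (pi / 2 / real m) / a ^ m) at_top"
proof -
  define y where "y = inverse (complex_of_real a)"
  have I: "((\<lambda>t. inverse (Complex a t) ^ j) \<longlongrightarrow> 0) at_top" if "j > 0" for j
    using tendsto_power[OF tendsto_inverse_Complex_at_top, of a j] that by (simp add: power_0_left)
  have L: "((\<lambda>t. inverse (Complex a t) ^ m * of_real (ln t)) \<longlongrightarrow> 0) at_top"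
  proof (rule Lim_null_comparison)
    show "\<forall>\<^sub>F t in at_top. norm (inverse (Complex a t) ^ m * of_real (ln t)) \<le> ln t / t"
      using eventually_ge_at_top[of 1]
    proof eventually_elim
      case (elim t)
      have *: "norm (inverse (Complex a t)) \<le> 1 / t"
        using elim by (intro norm_inverse_Complex_le) simp
      have "norm (inverse (Complex a t)) ^ m \<le> (1 / t) ^ m"
        using * by (intro power_mono) auto
      also have "\<dots> \<le> (1 / t) ^ 1"
        using elim assms(2) by (intro power_decreasing) auto
      finally have "norm (inverse (Complex a t)) ^ m \<le> 1 / t" by simp
      hence "norm (inverse (Complex a t)) ^ m * ln t \<le> 1 / t * ln t"
        using elim by (intro mult_right_mono) auto
      thus ?case using elim by (simp add: norm_mult norm_power)
    qed
    show "((\<lambda>t::real. ln t / t) \<longlongrightarrow> 0) at_top" by real_asymp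
  qed
  \<comment> \<open>Factoring the positive real t out of a + i t splits off exactly ln t.\<close>
  have "((\<lambda>t. Ln (Complex (a / t) 1)) \<longlongrightarrow> Ln (Complex 0 1)) at_top"
  proof (intro tendsto_Ln tendsto_Complex tendsto_const)
    show "((\<lambda>t. a / t) \<longlongrightarrow> 0) at_top" by real_asymp
  qed (auto simp: complex_nonpos_Reals_iff)
  moreover have "\<forall>\<^sub>F t in at_top. Ln (Complex (a / t) 1) = Ln (Complex a t) - of_real (ln t)"
    using eventually_gt_at_top[of 0]
  proof eventually_elim
    case (elim t)
    have "Complex a t = of_real t * Complex (a / t) 1" using elim by (simp add: complex_eq_iff)
    moreover have "Complex (a / t) 1 \<noteq> 0" by (simp add: complex_eq_iff)
    ultimately show ?case using elim by (simp add: Ln_times_of_real Ln_of_real)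
  qed
  ultimately have Ln: "((\<lambda>t. Ln (Complex a t) - of_real (ln t)) \<longlongrightarrow> \<i> * of_real pi / 2) at_top"
    by (simp add: tendsto_cong flip: i_complex_of_real)
  have "((\<lambda>t. Re (\<i> / of_nat m * (inverse (Complex a t) ^ m * of_real (ln t)
           + y ^ m * (Ln (Complex a t) - of_real (ln t))
           - (\<Sum>j\<in>{1..<m}. y ^ (m - j) * inverse (Complex a t) ^ j / of_nat j))))
         \<longlongrightarrow> Re (\<i> / of_nat m * (0 + y ^ m * (\<i> * of_real pi / 2)
           - (\<Sum>j\<in>{1..<m}. y ^ (m - j) * 0 / of_nat j)))) at_top"
    by (intro tendsto_Re tendsto_mult tendsto_add tendsto_diff tendsto_const L Ln tendsto_sum
        tendsto_divide I) auto
  also have "\<i> / of_nat m * (0 + y ^ m * (\<i> * of_real pi / 2)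
           - (\<Sum>j\<in>{1..<m}. y ^ (m - j) * 0 / of_nat j)) =
           complex_of_real (- (pi / 2 / real m) / a ^ m)"
    by (simp add: y_def field_simps)
  finally show ?thesis by (simp add: ln_kernel_prim_def y_def algebra_simps)
qed

section \<open>Domination and integration of the kernels\<close>

text \<open>As \<open>n \<ge> 1\<close>, at least two factors a^2 + t^2 are available: one is
  bounded below by a^2, the other by 1 + t^2.\<close>

lemma abs_Re_inverse_power_Complex_le:
  assumes "a \<ge> 1" "n \<ge> 1"
  shows "\<bar>Re (inverse (Complex a t) ^ (2 * n + 2))\<bar> \<le> 1 / a\<^sup>2 * (1 / (1 + t\<^sup>2))"
proof -
  have "\<bar>Re (inverse (Complex a t) ^ (2 * n + 2))\<bar> \<le> norm (inverse (Complex a t) ^ (2 * n + 2))"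
    by (rule abs_Re_le_cmod)
  also have "\<dots> = inverse ((norm (Complex a t) ^ 2) ^ (n + 1))"
    by (simp only: norm_power norm_inverse power_inverse flip: power_mult) simp
  also have "norm (Complex a t) ^ 2 = a\<^sup>2 + t\<^sup>2" by (simp add: complex_norm)
  also have "inverse ((a\<^sup>2 + t\<^sup>2) ^ (n + 1)) \<le> inverse (a\<^sup>2 * (1 + t\<^sup>2))"
  proof (rule le_imp_inverse_le)
    have a: "1 \<le> a\<^sup>2" using assms by simp
    have "a\<^sup>2 * (1 + t\<^sup>2) \<le> (a\<^sup>2 + t\<^sup>2) ^ 1 * (a\<^sup>2 + t\<^sup>2)"
      using a by (intro mult_mono) auto
    also have "\<dots> \<le> (a\<^sup>2 + t\<^sup>2) ^ n * (a\<^sup>2 + t\<^sup>2)"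
      using a assms by (intro mult_right_mono power_increasing) (auto simp: add_increasing2)
    finally show "a\<^sup>2 * (1 + t\<^sup>2) \<le> (a\<^sup>2 + t\<^sup>2) ^ (n + 1)" by (simp add: mult.commute)
    show "0 < a\<^sup>2 * (1 + t\<^sup>2)" using assms by (auto intro!: mult_pos_pos add_pos_nonneg)
  qed
  also have "\<dots> = 1 / a\<^sup>2 * (1 / (1 + t\<^sup>2))" by (simp add: field_simps)
  finally show ?thesis .
qed

text \<open>The bound separates into a coefficient depending on \<open>a\<close> alone, later
  summed, and a fixed integrable function of \<open>x\<close>.\<close>

lemma abs_ln_kernel_le:
  assumes "a \<ge> 1" "n \<ge> 1" "0 < x" "x < 1"
  shows "\<bar>Re (inverse (Complex a (- ln x)) ^ (2 * n + 2)) * ln (- ln x) / x\<bar>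
           \<le> 1 / a\<^sup>2 * (4 / (sqrt (- ln x) * (1 - ln x)) / x)"
proof -
  define t where "t = - ln x"
  have t: "t > 0" using assms by (simp add: t_def)
  have "\<bar>Re (inverse (Complex a t) ^ (2 * n + 2))\<bar> * \<bar>ln t\<bar> / x
          \<le> 1 / a\<^sup>2 * (1 / (1 + t\<^sup>2)) * \<bar>ln t\<bar> / x"
    using assms by (intro divide_right_mono mult_right_mono abs_Re_inverse_power_Complex_le) auto
  also have "\<dots> = 1 / a\<^sup>2 * (\<bar>ln t\<bar> / (1 + t\<^sup>2) / x)" by simp
  also have "\<dots> \<le> 1 / a\<^sup>2 * (4 / (sqrt t * (1 + t)) / x)"
    using assms t by (intro mult_left_mono divide_right_mono abs_ln_div_le) auto
  finally show ?thesis using assms by (simp add: t_def abs_mult)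
qed

lemma isCont_Re_inverse_power_Complex:
  assumes "a > 0"
  shows "isCont (\<lambda>t. Re (inverse (Complex a t) ^ p)) t"
  using has_field_derivative_Re[OF has_vector_derivative_inverse_power_Complex[OF assms]]
  by (rule DERIV_isCont)

lemma set_integrable_ln_kernel:
  assumes "a \<ge> 1" "n \<ge> 1"
  shows "set_integrable lborel {0<..<1} (\<lambda>x. Re (inverse (Complex a (- ln x)) ^ (2 * n + 2)) * ln (- ln x) / x)"
proof (rule set_integrable_bound)
  show "set_integrable lborel {0<..<1} (\<lambda>x. 1 / a\<^sup>2 * (4 / (sqrt (- ln x) * (1 - ln x)) / x))"
    by (intro set_integrable_mult_right set_integrable_dominator)
  have "continuous_on {0<..<1} (\<lambda>x. Re (inverse (Complex a (- ln x)) ^ (2 * n + 2)) * ln (- ln x) / x)"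
  proof (intro continuous_on_divide continuous_on_mult continuous_on_ln)
    have "isCont (\<lambda>x. Re (inverse (Complex a (- ln x)) ^ (2 * n + 2))) x" if "x \<in> {0<..<1}" for x
      using that assms
      by (intro isCont_o2[OF _ isCont_Re_inverse_power_Complex, of x "\<lambda>x. - ln x"] continuous_intros) auto
    thus "continuous_on {0<..<1} (\<lambda>x. Re (inverse (Complex a (- ln x)) ^ (2 * n + 2)))"
      by (intro continuous_at_imp_continuous_on) auto
  qed (auto intro!: continuous_intros)
  thus "set_borel_measurable lborel {0<..<1} (\<lambda>x. Re (inverse (Complex a (- ln x)) ^ (2 * n + 2)) * ln (- ln x) / x)"
    unfolding set_borel_measurable_def
    unfolding measurable_lborel2
    by (rule borel_measurable_continuous_on_indicator[rotated]) simp
  show "AE x in lborel. x \<in> {0<..<1} \<longrightarrow>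
     norm (Re (inverse (Complex a (- ln x)) ^ (2 * n + 2)) * ln (- ln x) / x)
       \<le> norm (1 / a\<^sup>2 * (4 / (sqrt (- ln x) * (1 - ln x)) / x))"
    unfolding real_norm_def
    by (intro AE_I2 impI order_trans[OF abs_ln_kernel_le[OF assms] abs_ge_self]) simp_all
qed

text \<open>The value is the difference of the limits at infinity and at 0 of the real part of
  \<open>ln_kernel_prim (2 * n + 1) a\<close>.\<close>

lemma set_integral_ln_kernel:
  assumes "a \<ge> 1" "n \<ge> 1"
  shows "(LBINT x:{0<..<1}. Re (inverse (Complex a (- ln x)) ^ (2 * n + 2)) * ln (- ln x) / x)
           = - (pi / 2 / (2 * n + 1)) / a ^ (2 * n + 1)"
proof -
  have a: "a > 0" using assms by simp
  have "(LBINT x:{0<..<1}. Re (inverse (Complex a (- ln x)) ^ (2 * n + 2)) * ln (- ln x) / x)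
          = - (pi / 2 / real (2 * n + 1)) / a ^ (2 * n + 1) - 0"
  proof (rule set_integral_ln_pullback[where g = "\<lambda>t. Re (inverse (Complex a t) ^ (2 * n + 2)) * ln t"])
    fix t :: real assume t: "t > 0"
    show "((\<lambda>t. Re (ln_kernel_prim (2 * n + 1) a t)) has_real_derivative
             Re (inverse (Complex a t) ^ (2 * n + 2)) * ln t) (at t)"
      using has_field_derivative_Re[OF has_vector_derivative_ln_kernel_prim[OF a t, of "2 * n + 1"]]
      by simp
    show "isCont (\<lambda>t. Re (inverse (Complex a t) ^ (2 * n + 2)) * ln t) t"
      using t by (intro continuous_mult isCont_Re_inverse_power_Complex[OF a] isCont_ln) auto
  next
    show "((\<lambda>t. Re (ln_kernel_prim (2 * n + 1) a t)) \<longlongrightarrow> 0) (at_right 0)"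
      using a by (rule ln_kernel_prim_tendsto_0) simp
    show "((\<lambda>t. Re (ln_kernel_prim (2 * n + 1) a t)) \<longlongrightarrow>
            - (pi / 2 / real (2 * n + 1)) / a ^ (2 * n + 1)) at_top"
      using a by (rule ln_kernel_prim_tendsto_top) simp
  qed (rule set_integrable_ln_kernel[OF assms])
  thus ?thesis by simp
qed

section \<open>Exchanging sum and integral\<close>

text \<open>The real form of the result. The series represents \<open>K * h\<close>, so the exchange
  is carried out for this multiple and the nonzero \<open>K\<close> is cancelled at the end.\<close>

lemma polylog_ln_ln_integral:
  fixes n :: nat
  assumes "n \<ge> 1"
  defines "h \<equiv> \<lambda>x. Re (polylog (- 2 * int n - 1) (- (complex_of_real x)\<^sup>2)) * ln (ln (1 / x)) / x"
  shows "set_integrable lborel {0<..<1} h"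
    and "(LBINT x:{0<..<1}. h x) = (-1) ^ n * (1 - 1 / 2 ^ (2 * n + 1)) * (fact (2 * n) / 2)
           * (Re (zeta (of_nat (2 * n + 1))) / pi ^ (2 * n))"
proof -
  define a where "a = (\<lambda>k. pi * (real k + 1 / 2))"
  define g where "g = (\<lambda>k x. Re (inverse (Complex (a k) (- ln x)) ^ (2 * n + 2)) * ln (- ln x) / x)"
  define f where "f = (\<lambda>k x. indicator {0<..<1} x *\<^sub>R g k x)"
  define d where "d = (\<lambda>x. 4 / (sqrt (- ln x) * (1 - ln x)) / x)"
  define K where "K = (-1) ^ Suc n * 2 ^ (2 * n + 1) / (fact (2 * n + 1) :: real)"
  define Z where "Z = Re (zeta (of_nat (2 * n + 1)))"
  have "K \<noteq> 0" by (simp add: K_def)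
  have a_eq: "a k = pi / 2 * real (2 * k + 1)" for k by (simp add: a_def field_simps)
  \<comment> \<open>The kernel bounds require this; it holds because pi / 2 \<ge> 1.\<close>
  have a1: "a k \<ge> 1" for k
  proof -
    have "1 * 1 \<le> pi / 2 * real (2 * k + 1)"
      using pi_ge_two by (intro mult_mono) auto
    thus ?thesis by (simp only: a_eq)
  qed
  \<comment> \<open>Used with s = 2 to sum the dominating bounds and with s = 2n+1 to evaluate the
    integrated series.\<close>
  have inv_sums: "(\<lambda>k. 1 / a k ^ s) sums ((2 / pi) ^ s * ((1 - 1 / 2 ^ s) * Re (zeta (of_nat s))))"
    if "s \<ge> 2" for s
  proof -
    have "1 / a k ^ s = (2 / pi) ^ s * (1 / real (2 * k + 1) ^ s)" for k
      unfolding a_eq power_mult_distrib by (simp add: power_divide)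
    thus ?thesis using sums_mult[OF odd_power_sums[OF that], of "(2 / pi) ^ s"] by (simp only:)
  qed
  have f_sums: "(\<lambda>k. f k x) sums (indicator {0<..<1} x *\<^sub>R (K * h x))" for x
  proof (cases "x \<in> {0<..<1}")
    case True
    hence x: "0 < x" "x < 1" by auto
    have "(\<lambda>k. Re (inverse (Complex (a k) (- ln x)) ^ (2 * n + 2)) * (ln (- ln x) / x)) sums
            (K * Re (polylog (- 2 * int n - 1) (- (complex_of_real x)\<^sup>2)) * (ln (- ln x) / x))"
      unfolding a_def K_def by (rule sums_mult2[OF polylog_neg_odd_sums(1)[OF x]])
    moreover have "ln (1 / x) = - ln x" using x by (simp add: ln_div)
    ultimately show ?thesis using True by (simp only: f_def g_def h_def indicator_simps
          scaleR_one times_divide_eq_right times_divide_eq_left mult.assoc)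
  qed (simp add: f_def)
  have d_int: "set_integrable lborel {0<..<1} d"
    unfolding d_def by (rule set_integrable_dominator)
  have f_int: "integrable lborel (f k)" for k
    using set_integrable_ln_kernel[OF a1[of k] assms(1)]
    unfolding f_def g_def set_integrable_def .
  have f_norm: "(\<integral>x. norm (f k x) \<partial>lborel) \<le> 1 / a k ^ 2 * (LBINT x:{0<..<1}. d x)" for k
  proof -
    have "norm (f k x) \<le> indicator {0<..<1} x *\<^sub>R (1 / a k ^ 2 * d x)" for x
      using abs_ln_kernel_le[OF a1[of k] assms(1), of x]
      by (auto simp only: f_def g_def d_def indicator_def real_norm_def greaterThanLessThan_iff
            split: if_splits) auto
    hence "(\<integral>x. norm (f k x) \<partial>lborel) \<le> (LBINT x:{0<..<1}. 1 / a k ^ 2 * d x)"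
      unfolding set_lebesgue_integral_def
      using set_integrable_mult_right[OF d_int, of "1 / a k ^ 2"] f_int[of k]
      by (intro integral_mono integrable_norm) (auto simp only: set_integrable_def)
    thus ?thesis by (simp only: set_integral_mult_right)
  qed
  have summable_norm: "summable (\<lambda>k. \<integral>x. norm (f k x) \<partial>lborel)"
  proof (rule summable_comparison_test')
    show "summable (\<lambda>k. 1 / a k ^ 2 * (LBINT x:{0<..<1}. d x))"
      by (intro summable_mult2 sums_summable[OF inv_sums]) simp
    show "norm (\<integral>x. norm (f k x) \<partial>lborel) \<le> 1 / a k ^ 2 * (LBINT x:{0<..<1}. d x)"
      if "k \<ge> 0" for k
      using f_norm[of k] by simp
  qed
  have summable_pt: "summable (\<lambda>k. norm (f k x))" for x
  proof (cases "x \<in> {0<..<1}")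
    case True
    show ?thesis
    proof (rule summable_comparison_test')
      show "summable (\<lambda>k. 1 / a k ^ 2 * d x)"
        by (intro summable_mult2 sums_summable[OF inv_sums]) simp
      show "norm (norm (f k x)) \<le> 1 / a k ^ 2 * d x" if "k \<ge> 0" for k
        using abs_ln_kernel_le[OF a1[of k] assms(1), of x] True
        by (simp only: f_def g_def d_def indicator_simps real_norm_def greaterThanLessThan_iff
              scaleR_one abs_abs simp_thms)
    qed
  qed (simp add: f_def)
  \<comment> \<open>The three conditions of the exchange theorem: integrable terms, pointwise
    absolute convergence, summable L1 norms.\<close>
  note swap = f_int AE_I2[OF summable_pt] summable_norm
  have suminf_f: "(\<Sum>k. f k x) = indicator {0<..<1} x *\<^sub>R (K * h x)" for x
    using f_sums by (rule sums_unique[symmetric])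
  from integrable_suminf[OF swap] have "set_integrable lborel {0<..<1} (\<lambda>x. K * h x)"
    unfolding suminf_f set_integrable_def .
  thus "set_integrable lborel {0<..<1} h"
    using \<open>K \<noteq> 0\<close> by simp
  have "integral\<^sup>L lborel (f k) = - (pi / 2 / (2 * n + 1)) * (1 / a k ^ (2 * n + 1))" for k
    using set_integral_ln_kernel[OF a1[of k] assms(1)]
    unfolding f_def g_def set_lebesgue_integral_def by (simp only: times_divide_eq_right mult_1_right)
  with sums_integral[OF swap]
  have "(\<lambda>k. - (pi / 2 / (2 * n + 1)) * (1 / a k ^ (2 * n + 1))) sums (LBINT x:{0<..<1}. K * h x)"
    unfolding suminf_f set_lebesgue_integral_def by (simp only:)
  moreover have "(\<lambda>k. - (pi / 2 / (2 * n + 1)) * (1 / a k ^ (2 * n + 1))) sums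
      (- (pi / 2 / (2 * n + 1)) * ((2 / pi) ^ (2 * n + 1) * ((1 - 1 / 2 ^ (2 * n + 1)) * Z)))"
    unfolding Z_def by (intro sums_mult inv_sums) (use assms in simp)
  ultimately have "K * (LBINT x:{0<..<1}. h x) =
      - (pi / 2 / (2 * n + 1)) * ((2 / pi) ^ (2 * n + 1) * ((1 - 1 / 2 ^ (2 * n + 1)) * Z))"
    by (metis set_integral_mult_right sums_unique2)
  \<comment> \<open>Both sides reduce to the same multiple of zeta(2n+1): (2n+1)! / (2n)! gives the
    2n+1, and pi/2 * (2/pi)^(2n+1) = (2/pi)^(2n).\<close>
  also have "\<dots> = K * ((-1) ^ n * (1 - 1 / 2 ^ (2 * n + 1)) * (fact (2 * n) / 2) * (Z / pi ^ (2 * n)))"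
  proof -
    define c where "c = (1 - 1 / 2 ^ (2 * n + 1)) * Z"
    have "K * ((-1) ^ n * (fact (2 * n) / 2) * (c / pi ^ (2 * n))) =
            - (((-1) ^ n * (-1) ^ n) * 2 ^ (2 * n) / real (2 * n + 1) * c / pi ^ (2 * n))"
      by (simp add: K_def divide_simps del: of_nat_Suc)
    also have "(-1 :: real) ^ n * (-1) ^ n = 1" by (simp flip: power_mult_distrib)
    also have "- (1 * 2 ^ (2 * n) / real (2 * n + 1) * c / pi ^ (2 * n)) =
        - (pi / 2 / (2 * n + 1)) * ((2 / pi) ^ (2 * n + 1) * c)"
    proof -
      define N where "N = real (2 * n + 1)"
      show ?thesis unfolding N_def[symmetric] by (simp add: power_divide)
    qed
    finally have "- (pi / 2 / (2 * n + 1)) * ((2 / pi) ^ (2 * n + 1) * c) =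
        K * ((-1) ^ n * (fact (2 * n) / 2) * (c / pi ^ (2 * n)))" by (rule sym)
    moreover have "u * (d * Z / v) = d * u * (Z / v)" for u d v :: real by simp
    ultimately show ?thesis unfolding c_def by (simp only: mult.assoc mult.left_commute[of "(-1) ^ n"])
  qed
  finally show "(LBINT x:{0<..<1}. h x) = (-1) ^ n * (1 - 1 / 2 ^ (2 * n + 1)) * (fact (2 * n) / 2)
           * (Re (zeta (of_nat (2 * n + 1))) / pi ^ (2 * n))"
    using \<open>K \<noteq> 0\<close> unfolding Z_def by (rule mult_left_cancel[THEN iffD1, rotated])
qed

text \<open>The polylogarithm on the interval and the zeta value are real, so the complex claim is
  the real one embedded. Integrability is asserted as well because the integral of a non-integrable
  function is 0 by convention.\<close>

theorem proposition2p1: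
  fixes n :: nat
  assumes "n \<ge> 1"
  shows "set_integrable lborel {0<..<1::real}
           (\<lambda>x. polylog (- 2 * int n - 1) (- (complex_of_real x)\<^sup>2)
                  * complex_of_real (ln (ln (1 / x))) / complex_of_real x)
       \<and> (LBINT x:{0<..<1::real}.
            polylog (- 2 * int n - 1) (- (complex_of_real x)\<^sup>2)
              * complex_of_real (ln (ln (1 / x))) / complex_of_real x)
         = (-1) ^ n * (1 - 1 / 2 ^ (2 * n + 1)) * (fact (2 * n) / 2)
             * (zeta (of_nat (2 * n + 1)) / complex_of_real pi ^ (2 * n))"
proof -
  define h where "h = (\<lambda>x. Re (polylog (- 2 * int n - 1) (- (complex_of_real x)\<^sup>2)) * ln (ln (1 / x)) / x)"
  have eq: "polylog (- 2 * int n - 1) (- (complex_of_real x)\<^sup>2)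
              * complex_of_real (ln (ln (1 / x))) / complex_of_real x = complex_of_real (h x)"
    if "x \<in> {0<..<1}" for x
  proof -
    have "polylog (- 2 * int n - 1) (- (complex_of_real x)\<^sup>2) =
            of_real (Re (polylog (- 2 * int n - 1) (- (complex_of_real x)\<^sup>2)))"
      using polylog_neg_odd_sums(2)[of x n] that by (intro complex_eqI) auto
    thus ?thesis unfolding h_def by (metis of_real_divide of_real_mult)
  qed
  have zeta: "zeta (of_nat (2 * n + 1)) = of_real (Re (zeta (of_nat (2 * n + 1))))"
    using zeta_nat_sums(2)[of "2 * n + 1"] assms by (intro complex_eqI) auto
  note h = polylog_ln_ln_integral[OF assms, folded h_def]
  have "set_integrable lborel {0<..<1} (\<lambda>x. complex_of_real (h x))"
    using h(1) unfolding set_integrable_def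
    by (simp add: scaleR_conv_of_real flip: of_real_mult)
  moreover have "(LBINT x:{0<..<1}. complex_of_real (h x)) =
      (-1) ^ n * (1 - 1 / 2 ^ (2 * n + 1)) * (fact (2 * n) / 2)
             * (zeta (of_nat (2 * n + 1)) / complex_of_real pi ^ (2 * n))"
    unfolding set_integral_complex_of_real h(2) by (subst zeta) simp
  moreover have "set_integrable lborel {0<..<1} (\<lambda>x. polylog (- 2 * int n - 1) (- (complex_of_real x)\<^sup>2)
              * complex_of_real (ln (ln (1 / x))) / complex_of_real x) \<longleftrightarrow>
            set_integrable lborel {0<..<1} (\<lambda>x. complex_of_real (h x))"
    using eq by (intro set_integrable_cong) auto
  moreover have "(LBINT x:{0<..<1}. polylog (- 2 * int n - 1) (- (complex_of_real x)\<^sup>2)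
              * complex_of_real (ln (ln (1 / x))) / complex_of_real x) =
            (LBINT x:{0<..<1}. complex_of_real (h x))"
    using eq by (intro set_lebesgue_integral_cong) auto
  ultimately show ?thesis by simp
qed

end
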